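(* If $Y$ is a subgroup of $T_X(\mathbb F_q)$, then $I(Y)=I_L$ for a unique lattice $L$ with $(q-1)L_\beta\subseteq L\subseteq L_\beta$. Therefore, every subgroup of $T_X(\mathbb F_q)$ is of the form $V_{X(\mathbb F_q)}(I_L)$ for a lattice $L$ with $(q-1)L_\beta\subseteq L\subseteq L_\beta$.
   Context: $\mathbb K=\mathbb F_q$ is a finite field with algebraic closure $\overline{\mathbb K}$. $\Sigma$ is a complete simplicial fan in $\mathbb R^n$ with rays $\rho_1,\dots,\rho_r$ generated by primitive lattice vectors $\mathbf v_1,\dots,\mathbf v_r\in\mathbb Z^n$, and $X=X_\Sigma$ is the corresponding split toric variety over $\mathbb K$; its class group $\operatorname{Cl}X$ is assumed to be free. Let $\phi:\mathbb Z^n\to\mathbb Z^r$ be the $r\times n$ matrix with rows $\mathbf v_1,\dots,\mathbf v_r$, let $d=r-n$, and let $\beta:\mathbb Z^r\to\mathbb Z^d\cong \operatorname{Cl}X$ be an integer matrix such that $0\to\mathbb Z^n\xrightarrow{\phi}\mathbb Z^r\xrightarrow{\beta}\mathbb Z^d\to0$ is exact. $L_\beta=\operatorname{im}\phi=\ker\beta\subseteq\mathbb Z^r$, a lattice of rank $n$. The Cox ring $S=\mathbb K[x_1,\dots,x_r]$ is graded by $\deg x_j=\beta_j$, the $j$-th column of $\beta$; "homogeneous" refers to this grading. For a sublattice $L\subseteq L_\beta$, the lattice ideal is $I_L=\langle \mathbf x^{\mathbf m^+}-\mathbf x^{\mathbf m^-} : \mathbf m=\mathbf m^+-\mathbf m^-\in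 L\rangle\subseteq S$, where $\mathbf m^{\pm}\in\mathbb N^r$ are the positive and negative parts of $\mathbf m$. $B\subseteq S$ is the monomial ideal generated by $\prod_{\rho_i\not\subseteq\sigma}x_i$, $\sigma\in\Sigma$. $G=\{P\in(\overline{\mathbb K}^* )^r : \mathbf x^{\mathbf m}(P)=1 \text{ for all } \mathbf m\in L_\beta\}$, where $\mathbf x^{\mathbf a}(P)=p_1^{a_1}\cdots p_r^{a_r}$. $X(\mathbb K)$ is the set of orbits $[P]=G\cdot P$ with $P\in\mathbb K^r\setminus V(B)$; $T_X(\mathbb K)$ is the group (under coordinatewise multiplication) of orbits $[P]$ with $P\in(\mathbb K^* )^r$. For a homogeneous ideal $J$, $V_{X(\mathbb K)}(J)=\{[P]\in X(\mathbb K): F(P)=0\text{ for all homogeneous }F\in J\}$. For $Y\subseteq X(\mathbb F_q)$, the vanishing ideal $I(Y)\subseteq S$ is the ideal generated by the homogeneous polynomials vanishing at all points of $Y$. *)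

theory Defs
  imports
    "HOL-Analysis.Analysis"
    "HOL-Algebra.Algebraic_Closure_Type"
    "HOL-Library.Poly_Mapping"
begin

text \<open>
  Index types: \<open>'n\<close> indexes the coordinates of \<open>\<int>\<^sup>n\<close>, \<open>'r\<close> the rays (equivalently the variables of
  the Cox ring) and \<open>'d\<close> the coordinates of the class group \<open>\<int>\<^sup>d\<close>.
\<close>

subsection \<open>Fans\<close>

definition real_vec :: "int ^ 'n \<Rightarrow> real ^ 'n"
  where "real_vec v = (\<chi> i. real_of_int (v $ i))"

definition rational_polyhedral_cone :: "(real ^ 'n) set \<Rightarrow> bool"
  where "rational_polyhedral_cone \<sigma> \<longleftrightarrow> (\<exists>A. finite A \<and> \<sigma> = convex_cone hull (real_vec ` A))"

definition strongly_convex :: "(real ^ 'n) set \<Rightarrow> bool"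
  where "strongly_convex \<sigma> \<longleftrightarrow> \<sigma> \<inter> uminus ` \<sigma> = {0}"

definition simplicial_cone :: "(real ^ 'n) set \<Rightarrow> bool"
  where "simplicial_cone \<sigma> \<longleftrightarrow> (\<exists>A. finite A \<and> independent A \<and> \<sigma> = convex_cone hull A)"

text \<open>
  The empty set satisfies \<^const>\<open>face_of\<close> but is not a face of a cone in toric geometry.
\<close>

definition cone_face :: "(real ^ 'n) set \<Rightarrow> (real ^ 'n) set \<Rightarrow> bool"
  where "cone_face \<tau> \<sigma> \<longleftrightarrow> \<tau> face_of \<sigma> \<and> \<tau> \<noteq> {}"

definition fan :: "(real ^ 'n) set set \<Rightarrow> bool"
  where "fan \<Sigma> \<longleftrightarrow> finite \<Sigma>
    \<and> (\<forall>\<sigma>\<in>\<Sigma>. rational_polyhedral_cone \<sigma> \<and> strongly_convex \<sigma>)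
    \<and> (\<forall>\<sigma>\<in>\<Sigma>. \<forall>\<tau>. cone_face \<tau> \<sigma> \<longrightarrow> \<tau> \<in> \<Sigma>)
    \<and> (\<forall>\<sigma>\<in>\<Sigma>. \<forall>\<tau>\<in>\<Sigma>. cone_face (\<sigma> \<inter> \<tau>) \<sigma> \<and> cone_face (\<sigma> \<inter> \<tau>) \<tau>)"

definition complete_fan :: "(real ^ 'n) set set \<Rightarrow> bool"
  where "complete_fan \<Sigma> \<longleftrightarrow> fan \<Sigma> \<and> \<Union> \<Sigma> = UNIV"

definition simplicial_fan :: "(real ^ 'n) set set \<Rightarrow> bool"
  where "simplicial_fan \<Sigma> \<longleftrightarrow> fan \<Sigma> \<and> (\<forall>\<sigma>\<in>\<Sigma>. simplicial_cone \<sigma>)"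

definition primitive :: "int ^ 'n \<Rightarrow> bool"
  where "primitive v \<longleftrightarrow> Gcd (range (($) v)) = 1"

definition ray :: "int ^ 'n ^ 'r \<Rightarrow> 'r \<Rightarrow> (real ^ 'n) set"
  where "ray \<phi> i = convex_cone hull {real_vec (\<phi> $ i)}"

text \<open>The rows of \<open>\<phi>\<close> are the primitive generators of the rays of \<open>\<Sigma>\<close>, each ray occurring once.\<close>

definition ray_matrix :: "(real ^ 'n) set set \<Rightarrow> int ^ 'n ^ 'r \<Rightarrow> bool"
  where "ray_matrix \<Sigma> \<phi> \<longleftrightarrow>
    (\<forall>i. primitive (\<phi> $ i)) \<and> bij_betw (ray \<phi>) UNIV {\<rho> \<in> \<Sigma>. dim \<rho> = 1}"

subsection \<open>The exact sequence\<close>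

definition short_exact :: "int ^ 'n ^ 'r \<Rightarrow> int ^ 'r ^ 'd \<Rightarrow> bool"
  where "short_exact \<phi> \<beta> \<longleftrightarrow>
    inj ((*v) \<phi>) \<and> range ((*v) \<phi>) = {m. \<beta> *v m = 0} \<and> surj ((*v) \<beta>)"

definition rel_lattice :: "int ^ 'r ^ 'd \<Rightarrow> (int ^ 'r) set"
  where "rel_lattice \<beta> = {m. \<beta> *v m = 0}"

text \<open>
  Lattices are \<open>\<int>\<close>-submodules (\<open>int_module.subspace\<close>) of \<open>\<int>\<^sup>r\<close>; the ideal generated by a set in a
  commutative ring is its span (\<open>ring_ideal.span\<close>) in the ring regarded as a module over itself.
\<close>

global_interpretation int_module: Modules.module "(*s) :: int \<Rightarrow> int ^ 'r \<Rightarrow> int ^ 'r"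
  by unfold_locales (simp_all add: vec_eq_iff algebra_simps)

global_interpretation ring_ideal: Modules.module "(*) :: 'a::comm_ring_1 \<Rightarrow> 'a \<Rightarrow> 'a"
  by unfold_locales (simp_all add: algebra_simps)

subsection \<open>The Cox ring\<close>

text \<open>Polynomials in variables indexed by \<open>'r\<close>, as finitely supported maps on exponent vectors.\<close>

type_synonym ('r, 'k) cox = "(nat ^ 'r) \<Rightarrow>\<^sub>0 'k"

definition mono_x :: "nat ^ 'r \<Rightarrow> ('r, 'k::field) cox"
  where "mono_x a = Poly_Mapping.single a 1"

definition eval_x :: "('r::finite, 'k::field) cox \<Rightarrow> 'k ^ 'r \<Rightarrow> 'k"
  where "eval_x F P =
    (\<Sum>a\<in>Poly_Mapping.keys F. Poly_Mapping.lookup F a * (\<Prod>j\<in>UNIV. (P $ j) ^ (a $ j)))"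

definition cl_degree :: "int ^ 'r ^ 'd \<Rightarrow> nat ^ 'r \<Rightarrow> int ^ 'd"
  where "cl_degree \<beta> a = (\<Sum>j\<in>UNIV. int (a $ j) *s column j \<beta>)"

definition homogeneous :: "int ^ 'r ^ 'd \<Rightarrow> ('r, 'k::field) cox \<Rightarrow> bool"
  where "homogeneous \<beta> F \<longleftrightarrow> (\<exists>\<delta>. \<forall>a\<in>Poly_Mapping.keys F. cl_degree \<beta> a = \<delta>)"

definition pos_part :: "int ^ 'r \<Rightarrow> nat ^ 'r"
  where "pos_part m = (\<chi> j. nat (m $ j))"

definition neg_part :: "int ^ 'r \<Rightarrow> nat ^ 'r"
  where "neg_part m = (\<chi> j. nat (- (m $ j)))"

definition lattice_ideal :: "(int ^ 'r) set \<Rightarrow> ('r, 'k::field) cox set"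
  where "lattice_ideal L = ring_ideal.span {mono_x (pos_part m) - mono_x (neg_part m) | m. m \<in> L}"

definition irrelevant_ideal ::
    "(real ^ 'n) set set \<Rightarrow> int ^ 'n ^ 'r \<Rightarrow> ('r, 'k::field) cox set"
  where "irrelevant_ideal \<Sigma> \<phi> =
    ring_ideal.span {\<Prod>i\<in>{i. \<not> ray \<phi> i \<subseteq> \<sigma>}. mono_x (axis i 1) | \<sigma>. \<sigma> \<in> \<Sigma>}"

definition zero_locus :: "('r::finite, 'k::field) cox set \<Rightarrow> ('k ^ 'r) set"
  where "zero_locus J = {P. \<forall>F\<in>J. eval_x F P = 0}"

subsection \<open>Rational points of the toric variety\<close>

definition laurent_mono :: "int ^ 'r \<Rightarrow> 'a::field ^ 'r \<Rightarrow> 'a"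
  where "laurent_mono m P = (\<Prod>j\<in>UNIV. (P $ j) powi (m $ j))"

text \<open>
  Multiplication and \<open>1\<close> on \<open>'a ^ 'r\<close> are coordinatewise. Points over \<open>'k\<close> are grouped into orbits
  of a group of points over the algebraic closure, so an orbit is a set of vectors over \<open>'k alg_closure\<close>.
\<close>

definition quot_group :: "int ^ 'r ^ 'd \<Rightarrow> ('k::field alg_closure ^ 'r) set"
  where "quot_group \<beta> = {P. (\<forall>j. P $ j \<noteq> 0) \<and> (\<forall>m\<in>rel_lattice \<beta>. laurent_mono m P = 1)}"

definition orbit :: "int ^ 'r ^ 'd \<Rightarrow> 'k::field ^ 'r \<Rightarrow> ('k alg_closure ^ 'r) set"
  where "orbit \<beta> P = (\<lambda>g. g * (\<chi> j. to_ac (P $ j))) ` quot_group \<beta>"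

definition toric_points ::
    "(real ^ 'n) set set \<Rightarrow> int ^ 'n ^ 'r \<Rightarrow> int ^ 'r ^ 'd \<Rightarrow> ('k::field alg_closure ^ 'r) set set"
  where "toric_points \<Sigma> \<phi> \<beta> = {orbit \<beta> P | P :: 'k ^ 'r. P \<notin> zero_locus (irrelevant_ideal \<Sigma> \<phi>)}"

definition torus_points :: "int ^ 'r ^ 'd \<Rightarrow> ('k::field alg_closure ^ 'r) set monoid"
  where "torus_points \<beta> =
    \<lparr>carrier = {orbit \<beta> P | P :: 'k ^ 'r. \<forall>j. P $ j \<noteq> 0},
     monoid.mult = (\<lambda>A B. {a * b | a b. a \<in> A \<and> b \<in> B}),
     one = orbit \<beta> 1\<rparr>"

text \<open>
  A homogeneous polynomial vanishes at one representative of an orbit iff it vanishes at all of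
  them, so for homogeneous \<open>F\<close> the quantifier over \<open>P\<close> may be read either way.
\<close>

definition vanishes_at ::
    "int ^ 'r ^ 'd \<Rightarrow> ('r, 'k::field) cox \<Rightarrow> ('k alg_closure ^ 'r) set \<Rightarrow> bool"
  where "vanishes_at \<beta> F p \<longleftrightarrow> (\<forall>P. orbit \<beta> P = p \<longrightarrow> eval_x F P = 0)"

definition toric_zero_set ::
    "(real ^ 'n) set set \<Rightarrow> int ^ 'n ^ 'r \<Rightarrow> int ^ 'r ^ 'd \<Rightarrow> ('r, 'k::field) cox set
      \<Rightarrow> ('k alg_closure ^ 'r) set set"
  where "toric_zero_set \<Sigma> \<phi> \<beta> J =
    {p \<in> toric_points \<Sigma> \<phi> \<beta>. \<forall>F\<in>J. homogeneous \<beta> F \<longrightarrow> vanishes_at \<beta> F p}"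

definition vanishing_ideal ::
    "int ^ 'r ^ 'd \<Rightarrow> ('k::field alg_closure ^ 'r) set set \<Rightarrow> ('r, 'k) cox set"
  where "vanishing_ideal \<beta> Y =
    ring_ideal.span {F. homogeneous \<beta> F \<and> (\<forall>p\<in>Y. vanishes_at \<beta> F p)}"

definition intermediate_lattice :: "nat \<Rightarrow> int ^ 'r ^ 'd \<Rightarrow> (int ^ 'r) set \<Rightarrow> bool"
  where "intermediate_lattice q \<beta> L \<longleftrightarrow> int_module.subspace L
    \<and> (\<lambda>m. (int q - 1) *s m) ` rel_lattice \<beta> \<subseteq> L \<and> L \<subseteq> rel_lattice \<beta>"

end

theory Submission
  imports Defs
begin

text \<open>
  Write \<open>L\<^sub>\<beta>\<close> for the relation lattice and \<open>U\<close> for the set of all torus points \<open>P \<in> (K\<^sup>*)\<^sup>r\<close> whose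
  orbit lies in \<open>Y\<close> (\<open>torus_reps\<close>); it is closed under multiplication and contains \<open>1\<close>. The lattice
  belonging to \<open>Y\<close> is its annihilator \<open>L = {m \<in> L\<^sub>\<beta>. x\<^sup>m = 1 on U}\<close> (\<open>char_kernel\<close>). It contains
  \<open>(q - 1) L\<^sub>\<beta>\<close> because every nonzero element of \<open>K\<close> is a root of unity of order dividing \<open>q - 1\<close>.

  \<^emph>\<open>The vanishing ideal.\<close> The binomials of \<open>L\<close> are homogeneous and vanish on \<open>U\<close>, so \<open>I\<^sub>L\<close> lies in
  \<open>I(Y)\<close>. Conversely, let \<open>F\<close> be homogeneous and vanish on \<open>U\<close>. The monomials of \<open>F\<close> are characters of
  \<open>U\<close>, and two of them agree on \<open>U\<close> exactly if their exponents differ by an element of \<open>L\<close>; here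
  homogeneity supplies membership of the difference in \<open>L\<^sub>\<beta>\<close>. Distinct characters are linearly
  independent (\<open>characters_linearly_independent\<close>), hence the coefficients of \<open>F\<close> sum to zero over each
  class of exponents modulo \<open>L\<close>, and such an \<open>F\<close> is a combination of differences \<open>x\<^sup>a - x\<^sup>b\<close> with
  \<open>a - b \<in> L\<close>.

  \<^emph>\<open>Uniqueness.\<close> The sums of coefficients over the classes modulo a lattice \<open>L\<close> are linear functionals
  that vanish on \<open>I\<^sub>L\<close> (\<open>class_sum_lattice_ideal\<close>). They detect which binomials lie in \<open>I\<^sub>L\<close>, so \<open>I\<^sub>L\<close>
  determines \<open>L\<close>.

  \<^emph>\<open>The zero set.\<close> For any set \<open>Y\<close> of torus orbits, the zero set of \<open>I(Y)\<close> in \<open>X\<close> is \<open>Y\<close>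
  (\<open>toric_zero_set_vanishing_ideal\<close>). A torus point outside \<open>Y\<close> is separated from each point of \<open>U\<close> by
  a homogeneous binomial with coefficients, and the product of these finitely many binomials
  vanishes on \<open>Y\<close> but not at the point. A point \<open>P\<close> off the torus has its zero coordinates among the
  rays of one cone of the fan; a linear form positive on that cone gives an \<open>m \<in> L\<^sub>\<beta>\<close> that is positive
  at all zero coordinates of \<open>P\<close>, and then the binomial of \<open>(q - 1) m\<close>, which vanishes on the whole
  torus, does not vanish at \<open>P\<close>.
\<close>

text \<open>
  A commutative ring regarded as a module over itself makes \<open>a * (b * x) = (a * b) * x\<close> a rewrite
  rule. It would loop with the right-associating rules in \<open>ac_simps\<close> and \<open>algebra_simps\<close>.
\<close>

declare ring_ideal.scale_scale [simp del]

section \<open>Monomials and evaluation\<close>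

definition monom_val :: "nat ^ 'r \<Rightarrow> 'k::field ^ 'r \<Rightarrow> 'k"
  where "monom_val a P = (\<Prod>j\<in>UNIV. (P $ j) ^ (a $ j))"

definition in_torus :: "'k::field ^ 'r \<Rightarrow> bool"
  where "in_torus P \<longleftrightarrow> (\<forall>j. P $ j \<noteq> 0)"

definition int_vec :: "nat ^ 'r \<Rightarrow> int ^ 'r"
  where "int_vec a = (\<chi> j. int (a $ j))"

lemma monom_val_0 [simp]: "monom_val 0 P = 1"
  by (simp add: monom_val_def)

lemma monom_val_add: "monom_val (a + b) P = monom_val a P * monom_val b P"
  by (simp add: monom_val_def power_add prod.distrib)

lemma monom_val_mult: "monom_val a (P * Q) = monom_val a P * monom_val a Q"
  by (simp add: monom_val_def power_mult_distrib prod.distrib)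

lemma monom_val_1 [simp]: "monom_val a 1 = 1"
  by (simp add: monom_val_def)

lemma monom_val_nonzero: "in_torus P \<Longrightarrow> monom_val a P \<noteq> 0"
  by (simp add: monom_val_def in_torus_def)

lemma laurent_mono_nonzero: "in_torus P \<Longrightarrow> laurent_mono m P \<noteq> 0"
  by (simp add: laurent_mono_def in_torus_def)

lemma laurent_mono_0 [simp]: "laurent_mono 0 P = 1"
  by (simp add: laurent_mono_def)

lemma laurent_mono_1 [simp]: "laurent_mono m 1 = 1"
  by (simp add: laurent_mono_def)

lemma laurent_mono_add:
  "in_torus P \<Longrightarrow> laurent_mono (m + m') P = laurent_mono m P * laurent_mono m' P"
  by (simp add: laurent_mono_def in_torus_def power_int_add prod.distrib)

lemma laurent_mono_scale:
  fixes m :: "int ^ 'r" and P :: "'k::field ^ 'r"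
  shows "laurent_mono (c *s m) P = laurent_mono m P powi c"
proof -
  have "(\<Prod>j\<in>I. f j) powi c = (\<Prod>j\<in>I. f j powi c)" for f :: "'r \<Rightarrow> 'k" and I
    by (induction I rule: infinite_finite_induct) (simp_all add: power_int_mult_distrib)
  moreover have "x powi (c * k) = (x powi k) powi c" for x :: 'k and k
    by (metis mult.commute power_int_mult)
  ultimately show ?thesis
    by (simp add: laurent_mono_def)
qed

lemma laurent_mono_mult: "laurent_mono m (P * Q) = laurent_mono m P * laurent_mono m Q"
  by (simp add: laurent_mono_def power_int_mult_distrib prod.distrib)

lemma laurent_mono_int_vec: "laurent_mono (int_vec a) P = monom_val a P"
  by (simp add: laurent_mono_def int_vec_def monom_val_def)

lemma laurent_mono_int_vec_diff:
  assumes "in_torus P"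
  shows "laurent_mono (int_vec a - int_vec b) P = monom_val a P / monom_val b P"
proof -
  have "laurent_mono (int_vec a - int_vec b) P * monom_val b P = monom_val a P"
    using laurent_mono_add[OF assms, of "int_vec a - int_vec b" "int_vec b"]
    by (simp add: laurent_mono_int_vec)
  then show ?thesis
    using monom_val_nonzero[OF assms, of b] by (simp add: field_simps)
qed

lemma monom_val_eq_iff:
  assumes "in_torus P"
  shows "monom_val a P = monom_val b P \<longleftrightarrow> laurent_mono (int_vec a - int_vec b) P = 1"
  using monom_val_nonzero[OF assms, of b]
  by (simp add: laurent_mono_int_vec_diff[OF assms])

lemma pos_part_minus_neg_part: "int_vec (pos_part m) - int_vec (neg_part m) = m"
  by (simp add: vec_eq_iff int_vec_def pos_part_def neg_part_def)

text \<open>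
  Multiplication by \<open>x\<close> permutes the nonzero elements, so it does not change their product, which on
  the other hand gets multiplied by one factor \<open>x\<close> for each of them.
\<close>

lemma finite_field_power_card_minus_1:
  fixes x :: "'k::{field,finite}"
  assumes "x \<noteq> 0"
  shows "x ^ (CARD('k) - 1) = 1"
proof -
  let ?U = "UNIV - {0 :: 'k}"
  have "bij_betw ((*) x) ?U ?U"
    by (rule bij_betw_byWitness[where f' = "\<lambda>y. y / x"]) (use assms in auto)
  then have "(\<Prod>y\<in>?U. y) = (\<Prod>y\<in>?U. x * y)"
    by (rule prod.reindex_bij_betw[symmetric])
  also have "\<dots> = x ^ (CARD('k) - 1) * (\<Prod>y\<in>?U. y)"
    by (simp add: prod.distrib card_Diff_singleton)
  finally show ?thesis
    by simp
qed

lemma laurent_mono_scale_card: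
  fixes P :: "'k::{field,finite} ^ 'r"
  assumes "in_torus P"
  shows "laurent_mono ((int CARD('k) - 1) *s m) P = 1"
proof -
  have "int CARD('k) - 1 = int (CARD('k) - 1)"
    by (simp add: of_nat_diff Suc_leI)
  then show ?thesis
    using finite_field_power_card_minus_1[OF laurent_mono_nonzero[OF assms]]
    by (simp only: laurent_mono_scale power_int_of_nat)
qed

subsection \<open>Evaluation is a ring homomorphism\<close>

lemma eval_x_superset:
  assumes "finite S" "Poly_Mapping.keys F \<subseteq> S"
  shows "eval_x F P = (\<Sum>a\<in>S. Poly_Mapping.lookup F a * monom_val a P)"
  unfolding eval_x_def monom_val_def[symmetric]
  by (rule sum.mono_neutral_left) (use assms in \<open>auto simp: in_keys_iff\<close>)

lemma eval_x_0 [simp]: "eval_x 0 P = 0"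
  by (simp add: eval_x_def)

lemma eval_x_add: "eval_x (F + G) P = eval_x F P + eval_x G P"
proof -
  let ?S = "Poly_Mapping.keys F \<union> Poly_Mapping.keys G"
  have "Poly_Mapping.keys (F + G) \<subseteq> ?S"
    by (rule keys_add)
  then show ?thesis
    by (simp add: eval_x_superset[of ?S] lookup_add algebra_simps sum.distrib)
qed

lemma eval_x_sum: "eval_x (\<Sum>i\<in>I. F i) P = (\<Sum>i\<in>I. eval_x (F i) P)"
  by (induction I rule: infinite_finite_induct) (simp_all add: eval_x_add)

lemma eval_x_diff: "eval_x (F - G) P = eval_x F P - eval_x G P"
  using eval_x_add[of "F - G" G P] by simp

lemma eval_x_single: "eval_x (Poly_Mapping.single a c) P = c * monom_val a P"
  by (simp add: eval_x_superset[of "{a}"])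

lemma eval_x_mono_x: "eval_x (mono_x a) P = monom_val a P"
  by (simp add: mono_x_def eval_x_single)

lemma sum_single_lookup:
  "(\<Sum>a\<in>Poly_Mapping.keys F. Poly_Mapping.single a (Poly_Mapping.lookup F a)) = F"
  by (rule poly_mapping_eqI)
    (auto simp: lookup_sum lookup_single when_def in_keys_iff intro: sum.neutral)

lemma eval_x_mult: "eval_x (F * G) P = eval_x F P * eval_x G P"
proof -
  have "F * G = (\<Sum>a\<in>Poly_Mapping.keys F. \<Sum>b\<in>Poly_Mapping.keys G.
      Poly_Mapping.single (a + b) (Poly_Mapping.lookup F a * Poly_Mapping.lookup G b))"
    by (simp only: mult_single[symmetric] sum_product[symmetric] sum_single_lookup)
  then have "eval_x (F * G) P = (\<Sum>a\<in>Poly_Mapping.keys F. \<Sum>b\<in>Poly_Mapping.keys G.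
      Poly_Mapping.lookup F a * Poly_Mapping.lookup G b * monom_val (a + b) P)"
    by (simp only: eval_x_sum eval_x_single)
  also have "\<dots> = (\<Sum>a\<in>Poly_Mapping.keys F. \<Sum>b\<in>Poly_Mapping.keys G.
      (Poly_Mapping.lookup F a * monom_val a P) * (Poly_Mapping.lookup G b * monom_val b P))"
    by (simp only: monom_val_add mult_ac)
  also have "\<dots> = eval_x F P * eval_x G P"
    by (simp only: sum_product[symmetric] eval_x_def monom_val_def)
  finally show ?thesis .
qed

lemma eval_x_prod: "eval_x (\<Prod>i\<in>I. F i) P = (\<Prod>i\<in>I. eval_x (F i) P)"
proof -
  have "eval_x 1 P = 1"
    by (metis eval_x_mono_x mono_x_def monom_val_0 single_one)
  then show ?thesis
    by (induction I rule: infinite_finite_induct) (simp_all add: eval_x_mult)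
qed

lemma eval_x_span_eq_0:
  assumes "F \<in> ring_ideal.span S" "\<And>G. G \<in> S \<Longrightarrow> eval_x G P = 0"
  shows "eval_x F P = 0"
  using assms(1)
  by (induction rule: ring_ideal.span_induct_alt) (simp_all add: eval_x_add eval_x_mult assms(2))

section \<open>Grading\<close>

lemma cl_degree_eq: "cl_degree \<beta> a = \<beta> *v int_vec a"
  by (simp add: cl_degree_def matrix_mult_sum int_vec_def)

lemma cl_degree_eq_iff:
  "cl_degree \<beta> a = cl_degree \<beta> b \<longleftrightarrow> int_vec a - int_vec b \<in> rel_lattice \<beta>"
  by (simp add: cl_degree_eq rel_lattice_def matrix_vector_mult_diff_distrib)

lemma cl_degree_add: "cl_degree \<beta> (a + b) = cl_degree \<beta> a + cl_degree \<beta> b"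
  by (simp add: cl_degree_def sum.distrib algebra_simps)

text \<open>
  The relation lattice consists of the differences of exponents of equal degree. The coefficients
  are arbitrary because separating two points requires binomials other than the pure differences.
\<close>

lemma homogeneous_binomial:
  assumes "m \<in> rel_lattice \<beta>"
  shows "homogeneous \<beta> (Poly_Mapping.single (pos_part m) c + Poly_Mapping.single (neg_part m) d)"
proof -
  have "cl_degree \<beta> (pos_part m) = cl_degree \<beta> (neg_part m)"
    using assms by (simp add: cl_degree_eq_iff pos_part_minus_neg_part)
  then have "\<forall>a\<in>Poly_Mapping.keys (Poly_Mapping.single (pos_part m) c
      + Poly_Mapping.single (neg_part m) d). cl_degree \<beta> a = cl_degree \<beta> (pos_part m)"
    using keys_add[of "Poly_Mapping.single (pos_part m) c" "Poly_Mapping.single (neg_part m) d"]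
    by (auto split: if_splits)
  then show ?thesis
    unfolding homogeneous_def by blast
qed

lemma homogeneous_lattice_binomial:
  "m \<in> rel_lattice \<beta> \<Longrightarrow> homogeneous \<beta> (mono_x (pos_part m) - mono_x (neg_part m))"
  using homogeneous_binomial[of m \<beta> 1 "-1"] by (simp add: mono_x_def single_uminus)

lemma homogeneous_mult:
  assumes "homogeneous \<beta> F" "homogeneous \<beta> G"
  shows "homogeneous \<beta> (F * G)"
proof -
  obtain \<delta> \<epsilon> where "\<forall>a\<in>Poly_Mapping.keys F. cl_degree \<beta> a = \<delta>"
    "\<forall>a\<in>Poly_Mapping.keys G. cl_degree \<beta> a = \<epsilon>"
    using assms unfolding homogeneous_def by blast
  then have "\<forall>a\<in>Poly_Mapping.keys (F * G). cl_degree \<beta> a = \<delta> + \<epsilon>"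
    using keys_mult[of F G] by (auto simp: cl_degree_add)
  then show ?thesis
    unfolding homogeneous_def by blast
qed

lemma homogeneous_prod:
  "(\<And>i. i \<in> I \<Longrightarrow> homogeneous \<beta> (F i)) \<Longrightarrow> homogeneous \<beta> (\<Prod>i\<in>I. F i)"
proof (induction I rule: infinite_finite_induct)
  case (insert i I)
  then show ?case
    by (simp add: homogeneous_mult)
qed (auto simp: homogeneous_def)

section \<open>Lattice ideals\<close>

text \<open>
  Cancelling the greatest common divisor \<open>x\<^sup>c\<close> of \<open>x\<^sup>a\<close> and \<open>x\<^sup>b\<close> leaves the positive and the negative
  part of \<open>a - b\<close> as exponents, so the difference is \<open>x\<^sup>c\<close> times a generator.
\<close>

lemma monom_diff_in_lattice_ideal:
  assumes "int_vec a - int_vec b \<in> L"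
  shows "mono_x a - mono_x b \<in> lattice_ideal L"
proof -
  define m where "m = int_vec a - int_vec b"
  define c :: "nat ^ 'a" where "c = (\<chi> j. min (a $ j) (b $ j))"
  have "a = c + pos_part m" "b = c + neg_part m"
    by (simp_all add: vec_eq_iff c_def m_def pos_part_def neg_part_def int_vec_def min_def) linarith+
  then have *: "mono_x a - mono_x b
      = mono_x c * (mono_x (pos_part m) - mono_x (neg_part m) :: ('a, 'b) cox)"
    by (simp add: mono_x_def right_diff_distrib mult_single)
  have "m \<in> L"
    using assms by (simp add: m_def)
  then show ?thesis
    unfolding lattice_ideal_def *
    by (intro ring_ideal.span_scale ring_ideal.span_base) blast
qed

text \<open>
  The coefficient of the class of \<open>c\<close> in the image of \<open>F\<close> under the natural map from the polynomial
  ring to the group algebra of \<open>\<int>\<^sup>r\<close> modulo \<open>L\<close>.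
\<close>

definition class_sum :: "(int ^ 'r) set \<Rightarrow> nat ^ 'r \<Rightarrow> ('r, 'k::field) cox \<Rightarrow> 'k"
  where "class_sum L c F =
    (\<Sum>a\<in>{a \<in> Poly_Mapping.keys F. int_vec a - int_vec c \<in> L}. Poly_Mapping.lookup F a)"

lemma class_sum_superset:
  assumes "finite S" "Poly_Mapping.keys F \<subseteq> S"
  shows "class_sum L c F = (\<Sum>a\<in>S. if int_vec a - int_vec c \<in> L then Poly_Mapping.lookup F a else 0)"
proof -
  have "class_sum L c F
      = (\<Sum>a\<in>Poly_Mapping.keys F. if int_vec a - int_vec c \<in> L then Poly_Mapping.lookup F a else 0)"
    by (simp add: class_sum_def sum.inter_filter)
  also have "\<dots> = (\<Sum>a\<in>S. if int_vec a - int_vec c \<in> L then Poly_Mapping.lookup F a else 0)"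
    by (rule sum.mono_neutral_left) (use assms in \<open>auto simp: in_keys_iff\<close>)
  finally show ?thesis .
qed

lemma class_sum_add: "class_sum L c (F + G) = class_sum L c F + class_sum L c G"
proof -
  let ?S = "Poly_Mapping.keys F \<union> Poly_Mapping.keys G"
  have "Poly_Mapping.keys (F + G) \<subseteq> ?S"
    by (rule keys_add)
  then show ?thesis
    by (simp only: class_sum_superset[of ?S] finite_UnI finite_keys Un_upper1 Un_upper2
        sum.distrib[symmetric]) (rule sum.cong, simp_all add: lookup_add)
qed

lemma class_sum_0 [simp]: "class_sum L c 0 = 0"
  by (simp add: class_sum_def)

lemma class_sum_sum: "class_sum L c (\<Sum>i\<in>I. F i) = (\<Sum>i\<in>I. class_sum L c (F i))"
  by (induction I rule: infinite_finite_induct) (simp_all add: class_sum_add)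

lemma class_sum_diff: "class_sum L c (F - G) = class_sum L c F - class_sum L c G"
  using class_sum_add[of L c "F - G" G] by simp

lemma class_sum_single:
  "class_sum L c (Poly_Mapping.single a k) = (if int_vec a - int_vec c \<in> L then k else 0)"
  by (simp add: class_sum_superset[of "{a}"])

lemma int_vec_add: "int_vec (a + b) = int_vec a + int_vec b"
  by (simp add: vec_eq_iff int_vec_def)

text \<open>
  In a multiple of a generator, every monomial of the cofactor contributes two monomials with
  opposite coefficients, whose exponents differ by an element of \<open>L\<close> and so lie in one class.
\<close>

lemma class_sum_lattice_ideal:
  assumes L: "int_module.subspace L" and F: "F \<in> lattice_ideal L"
  shows "class_sum L c F = 0"
  using F unfolding lattice_ideal_def
proof (induction rule: ring_ideal.span_induct_alt)
  case (step G B F)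
  then obtain m where m: "m \<in> L" and B: "B = mono_x (pos_part m) - mono_x (neg_part m)"
    by blast
  have same_class: "int_vec (b + pos_part m) - int_vec c \<in> L \<longleftrightarrow> int_vec (b + neg_part m) - int_vec c \<in> L"
    for b
  proof -
    have *: "int_vec (b + pos_part m) - int_vec c = (int_vec (b + neg_part m) - int_vec c) + m"
      using pos_part_minus_neg_part[of m] by (simp add: int_vec_add algebra_simps)
    show ?thesis
      unfolding * using m int_module.subspace_add[OF L] int_module.subspace_diff[OF L]
      by (metis add_diff_cancel_right')
  qed
  have "G * B = (\<Sum>b\<in>Poly_Mapping.keys G.
      Poly_Mapping.single (b + pos_part m) (Poly_Mapping.lookup G b)
      - Poly_Mapping.single (b + neg_part m) (Poly_Mapping.lookup G b))"
    by (subst sum_single_lookup[of G, symmetric])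
      (simp add: B mono_x_def sum_distrib_right right_diff_distrib mult_single sum_subtractf)
  then have "class_sum L c (G * B) = 0"
    by (simp add: class_sum_sum class_sum_diff class_sum_single same_class)
  with step show ?case
    by (simp add: class_sum_add)
qed simp

text \<open>
  If \<open>m\<close> were not in \<open>L\<close>, the two monomials of its binomial would lie in different classes, and the
  class sum at either of them would be \<open>1\<close> or \<open>-1\<close> instead of \<open>0\<close>.
\<close>

lemma lattice_mem_iff_binomial_mem:
  assumes L: "int_module.subspace L"
  shows "m \<in> L \<longleftrightarrow> (mono_x (pos_part m) - mono_x (neg_part m) :: ('r::finite, 'k::field) cox) \<in> lattice_ideal L"
proof
  assume "m \<in> L"
  then show "(mono_x (pos_part m) - mono_x (neg_part m) :: ('r, 'k) cox) \<in> lattice_ideal L"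
    unfolding lattice_ideal_def by (blast intro: ring_ideal.span_base)
next
  assume "(mono_x (pos_part m) - mono_x (neg_part m) :: ('r, 'k) cox) \<in> lattice_ideal L"
  from class_sum_lattice_ideal[OF L this, of "neg_part m"]
  show "m \<in> L"
    using int_module.subspace_0[OF L]
    by (auto simp: class_sum_diff class_sum_single mono_x_def pos_part_minus_neg_part split: if_splits)
qed

lemma lattice_ideal_inject:
  assumes "int_module.subspace L" "int_module.subspace L'"
    and "(lattice_ideal L :: ('r::finite, 'k::field) cox set) = lattice_ideal L'"
  shows "L = L'"
  using assms lattice_mem_iff_binomial_mem[where 'k = 'k] by blast

section \<open>Polynomials vanishing on a group of torus points\<close>

text \<open>
  Artin's proof of Dedekind's lemma. Substituting \<open>y * x\<close> for \<open>x\<close> in a relation and subtracting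
  \<open>\<psi> k y\<close> times the relation cancels the term of \<open>k\<close>; the coefficient of any other \<open>j\<close> is multiplied
  by \<open>\<psi> j y - \<psi> k y\<close>, which is nonzero for a suitable \<open>y\<close>.
\<close>

lemma characters_linearly_independent:
  fixes \<psi> :: "'i \<Rightarrow> 'a::monoid_mult \<Rightarrow> 'k::field"
  assumes one: "1 \<in> U" and closed: "\<And>x y. x \<in> U \<Longrightarrow> y \<in> U \<Longrightarrow> x * y \<in> U"
    and \<psi>_one: "\<And>i. \<psi> i 1 = 1" and \<psi>_mult: "\<And>i x y. \<psi> i (x * y) = \<psi> i x * \<psi> i y"
    and "finite I"
    and "\<And>i j. i \<in> I \<Longrightarrow> j \<in> I \<Longrightarrow> i \<noteq> j \<Longrightarrow> \<exists>x\<in>U. \<psi> i x \<noteq> \<psi> j x"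
    and "\<And>x. x \<in> U \<Longrightarrow> (\<Sum>i\<in>I. c i * \<psi> i x) = 0"
    and "i \<in> I"
  shows "c i = 0"
  using assms(5-)
proof (induction I arbitrary: c i rule: finite_induct)
  case (insert k J)
  have J: "c j = 0" if j: "j \<in> J" for j
  proof -
    have "j \<noteq> k"
      using insert.hyps(2) j by auto
    then obtain y where y: "y \<in> U" "\<psi> j y \<noteq> \<psi> k y"
      using insert.prems(1)[of j k] j by auto
    define c' where "c' i = c i * (\<psi> i y - \<psi> k y)" for i
    have "c' j = 0"
    proof (rule insert.IH[OF _ _ j])
      show "\<exists>x\<in>U. \<psi> a x \<noteq> \<psi> b x" if "a \<in> J" "b \<in> J" "a \<noteq> b" for a b
        using insert.prems(1)[of a b] that by blast
      show "(\<Sum>i\<in>J. c' i * \<psi> i x) = 0" if x: "x \<in> U" for x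
      proof -
        have "(\<Sum>i\<in>J. c' i * \<psi> i x) = (\<Sum>i\<in>insert k J. c' i * \<psi> i x)"
          by (subst sum.insert[OF insert.hyps]) (simp add: c'_def)
        also have "\<dots> = (\<Sum>i\<in>insert k J. c i * \<psi> i (y * x) - \<psi> k y * (c i * \<psi> i x))"
        proof (rule sum.cong[OF refl])
          show "c' i * \<psi> i x = c i * \<psi> i (y * x) - \<psi> k y * (c i * \<psi> i x)" for i
            unfolding c'_def \<psi>_mult by (simp only: left_diff_distrib right_diff_distrib mult.assoc mult.left_commute)
        qed
        also have "\<dots> = (\<Sum>i\<in>insert k J. c i * \<psi> i (y * x))
            - \<psi> k y * (\<Sum>i\<in>insert k J. c i * \<psi> i x)"
          by (simp only: sum_distrib_left sum_subtractf)
        also have "\<dots> = 0"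
          unfolding insert.prems(2)[OF x] insert.prems(2)[OF closed[OF y(1) x]] by simp
        finally show ?thesis .
      qed
    qed
    with y(2) show ?thesis
      by (simp add: c'_def)
  qed
  have "(\<Sum>i\<in>insert k J. c i * \<psi> i 1) = c k"
    by (subst sum.insert[OF insert.hyps]) (simp add: J \<psi>_one)
  then have "c k = 0"
    unfolding insert.prems(2)[OF one] by simp
  then show ?case
    using insert.prems(3) J by auto
qed simp

text \<open>
  The map \<open>r\<close> selects a representative among the monomials of \<open>F\<close> that agree on \<open>U\<close>. The
  representatives are distinct characters of \<open>U\<close>, so by linear independence replacing each monomial
  by its representative turns \<open>F\<close> into \<open>0\<close>; the replaced differences therefore sum to \<open>F\<close>.
\<close>

lemma vanishing_on_submonoid_decompose:
  fixes F :: "('r::finite, 'k::field) cox"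
  assumes one: "1 \<in> U" and closed: "\<And>P Q. P \<in> U \<Longrightarrow> Q \<in> U \<Longrightarrow> P * Q \<in> U"
    and vanish: "\<And>P. P \<in> U \<Longrightarrow> eval_x F P = 0"
  obtains r where
    "\<And>a. a \<in> Poly_Mapping.keys F \<Longrightarrow> r a \<in> Poly_Mapping.keys F"
    "\<And>a P. a \<in> Poly_Mapping.keys F \<Longrightarrow> P \<in> U \<Longrightarrow> monom_val a P = monom_val (r a) P"
    "F = (\<Sum>a\<in>Poly_Mapping.keys F. Poly_Mapping.single 0 (Poly_Mapping.lookup F a) * (mono_x a - mono_x (r a)))"
proof -
  let ?K = "Poly_Mapping.keys F"
  define r where "r a = (SOME b. b \<in> ?K \<and> (\<forall>P\<in>U. monom_val a P = monom_val b P))" for a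
  have r: "r a \<in> ?K \<and> (\<forall>P\<in>U. monom_val a P = monom_val (r a) P)" if "a \<in> ?K" for a
    unfolding r_def by (rule someI[of _ a]) (use that in simp)
  have r_cong: "r a = r b" if "\<forall>P\<in>U. monom_val a P = monom_val b P" for a b
    unfolding r_def using that by simp
  have class_zero: "(\<Sum>a | a \<in> ?K \<and> r a = b. Poly_Mapping.lookup F a) = 0" if "b \<in> r ` ?K" for b
  proof (rule characters_linearly_independent[where \<psi> = monom_val and U = U
        and c = "\<lambda>b. \<Sum>a | a \<in> ?K \<and> r a = b. Poly_Mapping.lookup F a" and I = "r ` ?K" and i = b])
    show "\<exists>P\<in>U. monom_val i P \<noteq> monom_val j P"
      if ij: "i \<in> r ` ?K" "j \<in> r ` ?K" "i \<noteq> j" for i j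
    proof (rule ccontr)
      assume "\<not> ?thesis"
      then have "r i = r j"
        by (intro r_cong) blast
      moreover have "r i = i" "r j = j"
        using ij r r_cong by (metis (no_types, lifting) imageE)+
      ultimately show False
        using ij(3) by simp
    qed
    show "(\<Sum>b\<in>r ` ?K. (\<Sum>a | a \<in> ?K \<and> r a = b. Poly_Mapping.lookup F a) * monom_val b P) = 0"
      if P: "P \<in> U" for P
    proof -
      have "(\<Sum>b\<in>r ` ?K. (\<Sum>a | a \<in> ?K \<and> r a = b. Poly_Mapping.lookup F a) * monom_val b P)
          = (\<Sum>b\<in>r ` ?K. \<Sum>a | a \<in> ?K \<and> r a = b. Poly_Mapping.lookup F a * monom_val a P)"
        using r P by (auto simp: sum_distrib_right intro!: sum.cong)
      also have "\<dots> = (\<Sum>a\<in>?K. Poly_Mapping.lookup F a * monom_val a P)"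
        by (rule sum.image_gen[symmetric]) simp
      also have "\<dots> = eval_x F P"
        by (simp add: eval_x_def monom_val_def)
      finally show ?thesis
        using vanish[OF P] by simp
    qed
  qed (use one closed that in \<open>auto simp: monom_val_mult\<close>)
  have "(\<Sum>a\<in>?K. Poly_Mapping.single (r a) (Poly_Mapping.lookup F a))
      = (\<Sum>b\<in>r ` ?K. \<Sum>a | a \<in> ?K \<and> r a = b. Poly_Mapping.single (r a) (Poly_Mapping.lookup F a))"
    by (rule sum.image_gen) simp
  also have "\<dots> = (\<Sum>b\<in>r ` ?K. Poly_Mapping.single b (\<Sum>a | a \<in> ?K \<and> r a = b. Poly_Mapping.lookup F a))"
  proof (rule sum.cong[OF refl])
    fix b :: "nat ^ 'r"
    have "Poly_Mapping.single b (sum (Poly_Mapping.lookup F) A)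
        = (\<Sum>a\<in>A. Poly_Mapping.single b (Poly_Mapping.lookup F a))" for A
      by (induction A rule: infinite_finite_induct) (simp_all add: single_add)
    then show "(\<Sum>a | a \<in> ?K \<and> r a = b. Poly_Mapping.single (r a) (Poly_Mapping.lookup F a))
        = Poly_Mapping.single b (\<Sum>a | a \<in> ?K \<and> r a = b. Poly_Mapping.lookup F a)"
      by simp
  qed
  also have "\<dots> = 0"
    using class_zero by simp
  finally have "(\<Sum>a\<in>?K. Poly_Mapping.single (r a) (Poly_Mapping.lookup F a)) = 0" .
  then have "F = (\<Sum>a\<in>?K. Poly_Mapping.single 0 (Poly_Mapping.lookup F a) * (mono_x a - mono_x (r a)))"
    by (simp add: mono_x_def right_diff_distrib mult_single sum_subtractf sum_single_lookup)
  with r that show thesis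
    by blast
qed

section \<open>Orbits\<close>

lemma to_ac_power_int: "to_ac (x powi n) = to_ac x powi n"
  by (simp add: power_int_def)

lemma laurent_mono_to_ac: "laurent_mono m (\<chi> j. to_ac (P $ j)) = to_ac (laurent_mono m P)"
  by (simp add: laurent_mono_def to_ac_prod to_ac_power_int)

lemma quot_group_mult:
  assumes "g \<in> quot_group \<beta>" "h \<in> quot_group \<beta>"
  shows "g * h \<in> quot_group \<beta>"
  using assms by (simp add: quot_group_def laurent_mono_mult)

lemma one_in_quot_group: "1 \<in> quot_group \<beta>"
  by (simp add: quot_group_def)

lemma orbit_subset:
  assumes "in_torus P" "in_torus Q"
    and "\<And>m. m \<in> rel_lattice \<beta> \<Longrightarrow> laurent_mono m P = laurent_mono m Q"
  shows "orbit \<beta> P \<subseteq> orbit \<beta> Q"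
proof
  fix x assume "x \<in> orbit \<beta> P"
  then obtain g where g: "g \<in> quot_group \<beta>" and x: "x = g * (\<chi> j. to_ac (P $ j))"
    unfolding orbit_def by blast
  \<comment> \<open>The group element that moves \<open>Q\<close> to \<open>P\<close>.\<close>
  define h where "h = (\<chi> j. to_ac (P $ j / Q $ j))"
  have h_mult: "P = (\<chi> j. P $ j / Q $ j) * Q"
    using assms(2) by (simp add: vec_eq_iff in_torus_def)
  have "laurent_mono m (\<chi> j. P $ j / Q $ j) = 1" if "m \<in> rel_lattice \<beta>" for m
    using assms(3)[OF that] arg_cong[OF h_mult, of "laurent_mono m"]
      laurent_mono_nonzero[OF assms(2), of m] by (simp add: laurent_mono_mult)
  then have "h \<in> quot_group \<beta>"
    using assms(1,2) laurent_mono_to_ac[of _ "\<chi> j. P $ j / Q $ j"]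
    by (simp add: quot_group_def h_def in_torus_def)
  moreover have "x = (g * h) * (\<chi> j. to_ac (Q $ j))"
    using assms(2) by (simp add: x h_def vec_eq_iff in_torus_def)
  ultimately show "x \<in> orbit \<beta> Q"
    unfolding orbit_def using quot_group_mult[OF g] by blast
qed

text \<open>
  The group acting on the points is cut out by the Laurent monomials of the relation lattice. Hence
  these monomials are a complete set of invariants of torus orbits, and whether two points over
  \<open>K\<close> share an orbit can be decided by values in \<open>K\<close>.
\<close>

lemma orbit_eq_iff:
  assumes "in_torus Q"
  shows "orbit \<beta> P = orbit \<beta> Q \<longleftrightarrow>
    in_torus P \<and> (\<forall>m\<in>rel_lattice \<beta>. laurent_mono m P = laurent_mono m Q)"
proof
  assume eq: "orbit \<beta> P = orbit \<beta> Q"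
  have "(\<chi> j. to_ac (P $ j)) \<in> orbit \<beta> P"
    unfolding orbit_def by (rule image_eqI[OF _ one_in_quot_group]) simp
  then obtain g where g: "g \<in> quot_group \<beta>"
    and P: "(\<chi> j. to_ac (P $ j)) = g * (\<chi> j. to_ac (Q $ j))"
    unfolding eq unfolding orbit_def by blast
  have "to_ac (P $ j) = g $ j * to_ac (Q $ j)" for j
    using arg_cong[OF P, of "\<lambda>v. v $ j"] by simp
  moreover have "g $ j \<noteq> 0" for j
    using g by (simp add: quot_group_def)
  ultimately have "in_torus P"
    using assms unfolding in_torus_def by (metis mult_eq_0_iff to_ac_eq_0_iff)
  moreover have "laurent_mono m P = laurent_mono m Q" if "m \<in> rel_lattice \<beta>" for m
  proof -
    have "laurent_mono m g = 1"
      using g that by (simp add: quot_group_def)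
    then have "to_ac (laurent_mono m P) = to_ac (laurent_mono m Q)"
      by (simp add: laurent_mono_to_ac[symmetric] P laurent_mono_mult)
    then show ?thesis
      by simp
  qed
  ultimately show "in_torus P \<and> (\<forall>m\<in>rel_lattice \<beta>. laurent_mono m P = laurent_mono m Q)"
    by blast
next
  assume "in_torus P \<and> (\<forall>m\<in>rel_lattice \<beta>. laurent_mono m P = laurent_mono m Q)"
  then show "orbit \<beta> P = orbit \<beta> Q"
    using orbit_subset[of P Q \<beta>] orbit_subset[of Q P \<beta>] assms by auto
qed

lemma orbit_mult:
  "{a * b | a b. a \<in> orbit \<beta> P \<and> b \<in> orbit \<beta> Q} = orbit \<beta> (P * Q)"
proof (intro equalityI subsetI)
  fix x assume "x \<in> {a * b | a b. a \<in> orbit \<beta> P \<and> b \<in> orbit \<beta> Q}"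
  then obtain g h where "g \<in> quot_group \<beta>" "h \<in> quot_group \<beta>"
    and x: "x = (g * (\<chi> j. to_ac (P $ j))) * (h * (\<chi> j. to_ac (Q $ j)))"
    unfolding orbit_def by blast
  moreover have "x = (g * h) * (\<chi> j. to_ac ((P * Q) $ j))"
    unfolding x by (simp add: vec_eq_iff)
  ultimately show "x \<in> orbit \<beta> (P * Q)"
    unfolding orbit_def using quot_group_mult by blast
next
  fix x assume "x \<in> orbit \<beta> (P * Q)"
  then obtain g where g: "g \<in> quot_group \<beta>" and x: "x = g * (\<chi> j. to_ac ((P * Q) $ j))"
    unfolding orbit_def by blast
  have "x = (g * (\<chi> j. to_ac (P $ j))) * (1 * (\<chi> j. to_ac (Q $ j)))"
    unfolding x by (simp add: vec_eq_iff)
  then show "x \<in> {a * b | a b. a \<in> orbit \<beta> P \<and> b \<in> orbit \<beta> Q}"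
    unfolding orbit_def using g one_in_quot_group by blast
qed

definition torus_reps ::
    "int ^ 'r ^ 'd \<Rightarrow> ('k::field alg_closure ^ 'r) set set \<Rightarrow> ('k ^ 'r) set"
  where "torus_reps \<beta> Y = {P. in_torus P \<and> orbit \<beta> P \<in> Y}"

lemma torus_reps_one:
  assumes "subgroup Y (torus_points \<beta>)"
  shows "1 \<in> torus_reps \<beta> Y"
  using subgroup.one_closed[OF assms] by (simp add: torus_reps_def in_torus_def torus_points_def)

lemma torus_reps_mult:
  assumes "subgroup Y (torus_points \<beta>)" "P \<in> torus_reps \<beta> Y" "Q \<in> torus_reps \<beta> Y"
  shows "P * Q \<in> torus_reps \<beta> Y"
  using subgroup.m_closed[OF assms(1), of "orbit \<beta> P" "orbit \<beta> Q"] assms(2,3)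
  by (simp add: torus_reps_def in_torus_def torus_points_def orbit_mult)

text \<open>
  Vanishing at an orbit quantifies over all points over \<open>K\<close> with that orbit. For an orbit of the
  torus none of them has a zero coordinate.
\<close>

lemma orbit_mem_imp_torus_rep:
  assumes "Y \<subseteq> carrier (torus_points \<beta>)" "orbit \<beta> P \<in> Y"
  shows "P \<in> torus_reps \<beta> Y"
proof -
  obtain Q where "orbit \<beta> P = orbit \<beta> Q" "in_torus Q"
    using assms by (auto simp: torus_points_def in_torus_def)
  then show ?thesis
    using assms(2) orbit_eq_iff[of Q \<beta> P] by (simp add: torus_reps_def)
qed

lemma vanishes_on_iff:
  assumes "Y \<subseteq> carrier (torus_points \<beta>)"
  shows "(\<forall>p\<in>Y. vanishes_at \<beta> F p) \<longleftrightarrow> (\<forall>P\<in>torus_reps \<beta> Y. eval_x F P = 0)"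
  using orbit_mem_imp_torus_rep[OF assms] by (auto simp: vanishes_at_def torus_reps_def)

section \<open>The vanishing ideal of a subgroup\<close>

definition char_kernel :: "int ^ 'r ^ 'd \<Rightarrow> ('k::field ^ 'r) set \<Rightarrow> (int ^ 'r) set"
  where "char_kernel \<beta> U = {m \<in> rel_lattice \<beta>. \<forall>P\<in>U. laurent_mono m P = 1}"

lemma rel_lattice_scale: "m \<in> rel_lattice \<beta> \<Longrightarrow> c *s m \<in> rel_lattice \<beta>"
proof -
  have "\<beta> *v (c *s m) = c *s (\<beta> *v m)"
    by (simp add: vec_eq_iff matrix_vector_mult_def sum_distrib_left mult_ac)
  then show "m \<in> rel_lattice \<beta> \<Longrightarrow> c *s m \<in> rel_lattice \<beta>"
    by (simp add: rel_lattice_def)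
qed

lemma rel_lattice_0: "0 \<in> rel_lattice \<beta>"
  by (simp add: rel_lattice_def)

lemma rel_lattice_add: "m \<in> rel_lattice \<beta> \<Longrightarrow> m' \<in> rel_lattice \<beta> \<Longrightarrow> m + m' \<in> rel_lattice \<beta>"
  by (simp add: rel_lattice_def matrix_vector_right_distrib)

lemma char_kernel_intermediate:
  fixes U :: "('k::{field,finite} ^ 'r) set" and \<beta> :: "int ^ 'r ^ 'd"
  assumes "\<And>P. P \<in> U \<Longrightarrow> in_torus P"
  shows "intermediate_lattice CARD('k) \<beta> (char_kernel \<beta> U)"
proof -
  have "int_module.subspace (char_kernel \<beta> U)"
    by (rule int_module.subspaceI)
      (use assms in \<open>auto simp: char_kernel_def laurent_mono_add laurent_mono_scale
        rel_lattice_0 rel_lattice_add rel_lattice_scale\<close>)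
  then show ?thesis
    using assms rel_lattice_scale[of _ \<beta> "int CARD('k) - 1"]
      laurent_mono_scale_card[where 'k = 'k and 'r = 'r]
    unfolding intermediate_lattice_def char_kernel_def by blast
qed

lemma lattice_ideal_subset_vanishing_ideal:
  fixes Y :: "('k::field alg_closure ^ 'r) set set"
  assumes Y: "Y \<subseteq> carrier (torus_points \<beta>)"
  shows "lattice_ideal (char_kernel \<beta> (torus_reps \<beta> Y)) \<subseteq> vanishing_ideal \<beta> Y"
  unfolding lattice_ideal_def vanishing_ideal_def
proof (rule ring_ideal.span_mono, rule subsetI)
  fix F :: "('r, 'k) cox"
  assume "F \<in> {mono_x (pos_part m) - mono_x (neg_part m) |m. m \<in> char_kernel \<beta> (torus_reps \<beta> Y)}"
  then obtain m where m: "m \<in> char_kernel \<beta> (torus_reps \<beta> Y)"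
    and F: "F = mono_x (pos_part m) - mono_x (neg_part m)"
    by blast
  have "homogeneous \<beta> F"
    using m by (simp add: F homogeneous_lattice_binomial char_kernel_def)
  moreover have "eval_x F P = 0" if "P \<in> torus_reps \<beta> Y" for P
    using that m by (simp add: F eval_x_diff eval_x_mono_x monom_val_eq_iff
        pos_part_minus_neg_part torus_reps_def char_kernel_def)
  ultimately show "F \<in> {F. homogeneous \<beta> F \<and> (\<forall>p\<in>Y. vanishes_at \<beta> F p)}"
    using vanishes_on_iff[OF Y] by blast
qed

text \<open>
  The differences \<open>x\<^sup>a - x\<^sup>b\<close> into which a homogeneous \<open>F\<close> decomposes join monomials that agree on the
  torus representatives, so \<open>a - b\<close> is annihilated by them; and \<open>a - b\<close> is in the relation lattice
  because both monomials occur in \<open>F\<close>.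
\<close>

lemma vanishing_ideal_subset_lattice_ideal:
  fixes Y :: "('k::field alg_closure ^ 'r) set set"
  assumes Y: "subgroup Y (torus_points \<beta>)"
  shows "vanishing_ideal \<beta> Y \<subseteq> lattice_ideal (char_kernel \<beta> (torus_reps \<beta> Y))"
    (is "_ \<subseteq> lattice_ideal ?L")
  unfolding vanishing_ideal_def
proof (rule ring_ideal.span_minimal)
  show "ring_ideal.subspace (lattice_ideal ?L)"
    unfolding lattice_ideal_def by (rule ring_ideal.subspace_span)
  show "{F. homogeneous \<beta> F \<and> (\<forall>p\<in>Y. vanishes_at \<beta> F p)} \<subseteq> lattice_ideal ?L"
  proof
    fix F assume "F \<in> {F. homogeneous \<beta> F \<and> (\<forall>p\<in>Y. vanishes_at \<beta> F p)}"
    then have hom: "homogeneous \<beta> F" and vanish: "\<And>P. P \<in> torus_reps \<beta> Y \<Longrightarrow> eval_x F P = 0"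
      using vanishes_on_iff[OF subgroup.subset[OF Y]] by auto
    obtain r where r: "\<And>a. a \<in> Poly_Mapping.keys F \<Longrightarrow> r a \<in> Poly_Mapping.keys F"
      "\<And>a P. a \<in> Poly_Mapping.keys F \<Longrightarrow> P \<in> torus_reps \<beta> Y \<Longrightarrow> monom_val a P = monom_val (r a) P"
      and F: "F = (\<Sum>a\<in>Poly_Mapping.keys F.
        Poly_Mapping.single 0 (Poly_Mapping.lookup F a) * (mono_x a - mono_x (r a)))"
      by (rule vanishing_on_submonoid_decompose[of "torus_reps \<beta> Y" F])
        (use torus_reps_one[OF Y] torus_reps_mult[OF Y] vanish in auto)
    have "mono_x a - mono_x (r a) \<in> (lattice_ideal ?L :: ('r, 'k) cox set)"
      if a: "a \<in> Poly_Mapping.keys F" for a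
    proof (rule monom_diff_in_lattice_ideal)
      have "cl_degree \<beta> a = cl_degree \<beta> (r a)"
        using hom r(1)[OF a] a unfolding homogeneous_def by metis
      then show "int_vec a - int_vec (r a) \<in> ?L"
        using r(2)[OF a] by (auto simp: char_kernel_def cl_degree_eq_iff torus_reps_def
            monom_val_eq_iff[symmetric])
    qed
    then show "F \<in> lattice_ideal ?L"
      by (subst F, unfold lattice_ideal_def) (intro ring_ideal.span_sum ring_ideal.span_scale)
  qed
qed

section \<open>Points cut out by a lattice ideal\<close>

text \<open>
  A linear form that is \<open>1\<close> on the linearly independent generators is positive on every nonzero
  nonnegative combination of them.
\<close>

lemma simplicial_cone_positive_functional:
  assumes "simplicial_cone \<sigma>"
  obtains w where "\<And>x. x \<in> \<sigma> \<Longrightarrow> x \<noteq> 0 \<Longrightarrow> 0 < x \<bullet> w"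
proof -
  obtain A where A: "independent A" "\<sigma> = convex_cone hull A"
    using assms unfolding simplicial_cone_def by blast
  obtain f :: "real ^ 'a \<Rightarrow> real" where f: "linear f" "\<And>a. a \<in> A \<Longrightarrow> f a = 1"
    using linear_independent_extend[OF A(1), of "\<lambda>_. 1"] by blast
  define w where "w = adjoint f 1"
  have w: "x \<bullet> w = f x" for x
    unfolding w_def using adjoint_works[OF f(1), of x 1] by simp
  have "convex_cone ({0} \<union> {x. 0 < x \<bullet> w})"
    unfolding convex_cone_iff
    by (auto simp: inner_add_left intro: add_pos_pos)
  then have "\<sigma> \<subseteq> {0} \<union> {x. 0 < x \<bullet> w}"
    unfolding A(2) using f(2) by (intro hull_minimal) (auto simp: w)
  then show thesis
    using that by blast
qed

text \<open>
  Finitely many strict inequalities survive rounding. Rounding \<open>N * w\<close> down to an integer vector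
  changes its product with row \<open>i\<close> by at most the sum \<open>C i\<close> of the absolute entries of that row,
  whereas the product itself is \<open>N * \<delta> i\<close>; so \<open>N\<close> has to exceed each \<open>C i / \<delta> i\<close>.
\<close>

lemma integral_positive_functional:
  fixes v :: "int ^ 'n ^ 'r"
  assumes "\<And>i. i \<in> Z \<Longrightarrow> 0 < real_vec (v $ i) \<bullet> w"
  obtains u where "\<And>i. i \<in> Z \<Longrightarrow> 0 < (v *v u) $ i"
proof -
  define C where "C i = (\<Sum>j\<in>UNIV. \<bar>real_of_int (v $ i $ j)\<bar>)" for i
  define \<delta> where "\<delta> i = real_vec (v $ i) \<bullet> w" for i
  define N where "N = (\<Sum>i\<in>Z. C i / \<delta> i) + 1"
  define u :: "int ^ 'n" where "u = (\<chi> j. \<lfloor>N * w $ j\<rfloor>)"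
  have C0: "0 \<le> C i" for i
    by (simp add: C_def sum_nonneg)
  have "0 < (v *v u) $ i" if i: "i \<in> Z" for i
  proof -
    have \<delta>: "0 < \<delta> i"
      using assms[OF i] by (simp add: \<delta>_def)
    have "C i / \<delta> i \<le> (\<Sum>i\<in>Z. C i / \<delta> i)"
      using assms i C0 by (intro member_le_sum) (auto simp: \<delta>_def less_imp_le)
    then have "C i / \<delta> i < N"
      by (simp add: N_def)
    then have NC: "0 < N * \<delta> i - C i"
      using \<delta> by (simp add: field_simps)
    have "N * \<delta> i - C i = (\<Sum>j\<in>UNIV. real_of_int (v $ i $ j) * (N * w $ j) - \<bar>real_of_int (v $ i $ j)\<bar>)"
      by (simp add: \<delta>_def C_def inner_vec_def real_vec_def sum_distrib_left sum_subtractf mult_ac)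
    also have "\<dots> \<le> (\<Sum>j\<in>UNIV. real_of_int (v $ i $ j) * real_of_int (u $ j))"
    proof (rule sum_mono)
      fix j
      have "\<bar>N * w $ j - u $ j\<bar> \<le> 1"
        using floor_correct[of "N * w $ j"] by (simp add: u_def abs_le_iff) linarith
      then have "\<bar>real_of_int (v $ i $ j)\<bar> * \<bar>N * w $ j - u $ j\<bar> \<le> \<bar>real_of_int (v $ i $ j)\<bar> * 1"
        by (intro mult_left_mono) auto
      moreover have "real_of_int (v $ i $ j) * (N * w $ j - u $ j)
          \<le> \<bar>real_of_int (v $ i $ j)\<bar> * \<bar>N * w $ j - u $ j\<bar>"
        by (metis abs_ge_self abs_mult)
      ultimately have "real_of_int (v $ i $ j) * (N * w $ j - u $ j) \<le> \<bar>real_of_int (v $ i $ j)\<bar>"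
        by linarith
      then show "real_of_int (v $ i $ j) * (N * w $ j) - \<bar>real_of_int (v $ i $ j)\<bar>
          \<le> real_of_int (v $ i $ j) * real_of_int (u $ j)"
        by (simp add: algebra_simps)
    qed
    also have "\<dots> = real_of_int ((v *v u) $ i)"
      by (simp add: matrix_vector_mult_def)
    finally show ?thesis
      using NC by linarith
  qed
  then show thesis
    using that by blast
qed

lemma monom_val_axis: "monom_val (axis i 1) P = P $ i"
proof -
  have "monom_val (axis i 1) P = (\<Prod>j\<in>UNIV. if j = i then P $ i else 1)"
    unfolding monom_val_def by (rule prod.cong) (auto simp: axis_def)
  then show ?thesis
    by simp
qed

text \<open>
  Some generator of the irrelevant ideal is nonzero at \<open>P\<close>, and it is the product of the variables
  of all rays outside one cone.
\<close>

lemma not_in_irrelevant_locus: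
  assumes "P \<notin> zero_locus (irrelevant_ideal \<Sigma> \<phi>)"
  obtains \<sigma> where "\<sigma> \<in> \<Sigma>" "\<And>i. P $ i = 0 \<Longrightarrow> ray \<phi> i \<subseteq> \<sigma>"
proof -
  obtain F where F: "F \<in> irrelevant_ideal \<Sigma> \<phi>" "eval_x F P \<noteq> 0"
    using assms by (auto simp: zero_locus_def)
  then obtain \<sigma> where "\<sigma> \<in> \<Sigma>" "eval_x (\<Prod>i\<in>{i. \<not> ray \<phi> i \<subseteq> \<sigma>}. mono_x (axis i 1)) P \<noteq> 0"
    unfolding irrelevant_ideal_def using eval_x_span_eq_0 by (smt (verit) mem_Collect_eq)
  then show thesis
    using that[of \<sigma>] by (auto simp: eval_x_prod eval_x_mono_x monom_val_axis[unfolded One_nat_def])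
qed

lemma torus_not_in_irrelevant_locus:
  assumes "in_torus P" "\<sigma> \<in> \<Sigma>"
  shows "P \<notin> zero_locus (irrelevant_ideal \<Sigma> \<phi>)"
proof -
  let ?F = "\<Prod>i\<in>{i. \<not> ray \<phi> i \<subseteq> \<sigma>}. mono_x (axis i 1)"
  have "?F \<in> irrelevant_ideal \<Sigma> \<phi>"
    unfolding irrelevant_ideal_def using assms(2) by (blast intro: ring_ideal.span_base)
  moreover have "eval_x ?F P \<noteq> 0"
    using assms(1) by (simp add: eval_x_prod eval_x_mono_x monom_val_axis[unfolded One_nat_def] in_torus_def)
  ultimately show ?thesis
    by (auto simp: zero_locus_def)
qed

text \<open>
  The linear form supplied by the cone containing the rays of the zero coordinates of \<open>P\<close> is, read
  through \<open>\<phi>\<close>, a vector of the relation lattice with positive entries at all these coordinates.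
  The positive part of each of its positive multiples thus involves a zero coordinate, and the
  negative part involves none. All positive multiples are covered because the binomial of \<open>m\<close>
  itself need not vanish on the torus, while that of \<open>(q - 1) m\<close> does.
\<close>

lemma boundary_point_witness:
  assumes fan: "simplicial_fan \<Sigma>" "ray_matrix \<Sigma> \<phi>" "short_exact \<phi> \<beta>"
    and P: "P \<notin> zero_locus (irrelevant_ideal \<Sigma> \<phi>)" "\<not> in_torus P"
  obtains m where "m \<in> rel_lattice \<beta>"
    "\<And>N. 0 < N \<Longrightarrow> monom_val (pos_part (N *s m)) P = 0"
    "\<And>N. 0 < N \<Longrightarrow> monom_val (neg_part (N *s m)) P \<noteq> 0"
proof -
  obtain \<sigma> where \<sigma>: "\<sigma> \<in> \<Sigma>" "\<And>i. P $ i = 0 \<Longrightarrow> ray \<phi> i \<subseteq> \<sigma>"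
    using not_in_irrelevant_locus[OF P(1)] by blast
  obtain w where w: "\<And>x. x \<in> \<sigma> \<Longrightarrow> x \<noteq> 0 \<Longrightarrow> 0 < x \<bullet> w"
    using simplicial_cone_positive_functional fan(1) \<sigma>(1) unfolding simplicial_fan_def by metis
  have pos: "0 < real_vec (\<phi> $ i) \<bullet> w" if "i \<in> {i. P $ i = 0}" for i
  proof (rule w)
    have "real_vec (\<phi> $ i) \<in> ray \<phi> i"
      unfolding ray_def by (rule hull_inc) simp
    then show "real_vec (\<phi> $ i) \<in> \<sigma>"
      using \<sigma>(2) that by blast
    have "primitive (\<phi> $ i)"
      using fan(2) by (simp add: ray_matrix_def)
    then have "\<phi> $ i \<noteq> 0"
      by (auto simp: primitive_def)
    then show "real_vec (\<phi> $ i) \<noteq> 0"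
      by (auto simp: real_vec_def vec_eq_iff)
  qed
  obtain u where u: "\<And>i. i \<in> {i. P $ i = 0} \<Longrightarrow> 0 < (\<phi> *v u) $ i"
    using integral_positive_functional[OF pos] by blast
  show thesis
  proof (rule that[of "\<phi> *v u"])
    show "\<phi> *v u \<in> rel_lattice \<beta>"
      using fan(3) by (auto simp: short_exact_def rel_lattice_def)
    fix N :: int assume N: "0 < N"
    obtain i where i: "P $ i = 0"
      using P(2) by (auto simp: in_torus_def)
    then show "monom_val (pos_part (N *s (\<phi> *v u))) P = 0"
      using u[of i] N by (auto simp: monom_val_def pos_part_def intro!: exI[of _ i])
    have "(neg_part (N *s (\<phi> *v u))) $ j = 0" if "P $ j = 0" for j
      using u[of j] N that by (simp add: neg_part_def)
    then show "monom_val (neg_part (N *s (\<phi> *v u))) P \<noteq> 0"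
      by (auto simp: monom_val_def)
  qed
qed

text \<open>
  For each \<open>Q\<close>, a Laurent monomial \<open>m\<close> of the relation lattice takes different values at \<open>P\<close> and \<open>Q\<close>;
  clearing denominators in the difference of \<open>x\<^sup>m\<close> and its value at \<open>Q\<close> gives a homogeneous binomial that is zero at \<open>Q\<close> but not at
  \<open>P\<close>. Their product over the finitely many \<open>Q\<close> is the required polynomial.
\<close>

lemma homogeneous_separation:
  fixes P :: "'k::{field,finite} ^ 'r" and \<beta> :: "int ^ 'r ^ 'd"
  assumes P: "in_torus P" "orbit \<beta> P \<notin> Y"
  obtains F where "homogeneous \<beta> F" "eval_x F P \<noteq> 0" "\<And>Q. Q \<in> torus_reps \<beta> Y \<Longrightarrow> eval_x F Q = 0"
proof -
  have "\<exists>G. homogeneous \<beta> G \<and> eval_x G P \<noteq> 0 \<and> eval_x G Q = 0" if Q: "Q \<in> torus_reps \<beta> Y" for Q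
  proof -
    have Qt: "in_torus Q" and "orbit \<beta> P \<noteq> orbit \<beta> Q"
      using Q P by (auto simp: torus_reps_def)
    then obtain m where m: "m \<in> rel_lattice \<beta>" "laurent_mono m P \<noteq> laurent_mono m Q"
      using P(1) orbit_eq_iff[OF Qt] by blast
    have m_eq: "laurent_mono m R = monom_val (pos_part m) R / monom_val (neg_part m) R"
      if "in_torus R" for R :: "'k ^ 'r"
      using laurent_mono_int_vec_diff[OF that, of "pos_part m" "neg_part m"]
      by (simp add: pos_part_minus_neg_part)
    let ?G = "Poly_Mapping.single (pos_part m) (monom_val (neg_part m) Q)
      + Poly_Mapping.single (neg_part m) (- monom_val (pos_part m) Q)"
    have "eval_x ?G P \<noteq> 0"
      using m(2) monom_val_nonzero[OF P(1), of "neg_part m"] monom_val_nonzero[OF Qt, of "neg_part m"]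
      by (simp add: m_eq P(1) Qt eval_x_add eval_x_single field_simps)
    moreover have "eval_x ?G Q = 0"
      by (simp add: eval_x_add eval_x_single)
    ultimately show ?thesis
      using homogeneous_binomial[OF m(1)] by blast
  qed
  then obtain G where G: "\<And>Q. Q \<in> torus_reps \<beta> Y \<Longrightarrow>
      homogeneous \<beta> (G Q) \<and> eval_x (G Q) P \<noteq> 0 \<and> eval_x (G Q) Q = 0"
    by metis
  have "finite (torus_reps \<beta> Y)"
    by simp
  with G show thesis
    by (intro that[of "\<Prod>Q\<in>torus_reps \<beta> Y. G Q"])
      (auto simp: eval_x_prod intro: homogeneous_prod)
qed

text \<open>
  The separating polynomials exclude the torus points outside \<open>Y\<close>. Points off the torus are excluded
  by binomials that vanish at every torus point over \<open>K\<close>.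
\<close>

lemma toric_zero_set_vanishing_ideal:
  fixes Y :: "('k::{field,finite} alg_closure ^ 'r) set set" and \<beta> :: "int ^ 'r ^ 'd"
  assumes fan: "simplicial_fan \<Sigma>" "ray_matrix \<Sigma> \<phi>" "short_exact \<phi> \<beta>" and ne: "\<Sigma> \<noteq> {}"
    and Y: "Y \<subseteq> carrier (torus_points \<beta>)"
  shows "toric_zero_set \<Sigma> \<phi> \<beta> (vanishing_ideal \<beta> Y) = Y"
proof (intro equalityI subsetI)
  fix p assume p: "p \<in> Y"
  then obtain P where P: "p = orbit \<beta> P" "in_torus P"
    using Y by (auto simp: torus_points_def in_torus_def)
  then have "p \<in> toric_points \<Sigma> \<phi> \<beta>"
    using torus_not_in_irrelevant_locus[OF P(2)] ne by (auto simp: toric_points_def)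
  moreover have "vanishes_at \<beta> F p" if F: "F \<in> vanishing_ideal \<beta> Y" for F
    unfolding vanishes_at_def
  proof (intro allI impI)
    fix Q :: "'k ^ 'r" assume Q: "orbit \<beta> Q = p"
    show "eval_x F Q = 0"
      using F unfolding vanishing_ideal_def
      by (rule eval_x_span_eq_0) (use p Q in \<open>auto simp: vanishes_at_def\<close>)
  qed
  ultimately show "p \<in> toric_zero_set \<Sigma> \<phi> \<beta> (vanishing_ideal \<beta> Y)"
    by (simp add: toric_zero_set_def)
next
  fix p assume p: "p \<in> toric_zero_set \<Sigma> \<phi> \<beta> (vanishing_ideal \<beta> Y)"
  then obtain P :: "'k ^ 'r" where P: "p = orbit \<beta> P" "P \<notin> zero_locus (irrelevant_ideal \<Sigma> \<phi>)"
    by (auto simp: toric_zero_set_def toric_points_def)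
  have vanish: "eval_x F P = 0"
    if "homogeneous \<beta> F" "\<And>Q. Q \<in> torus_reps \<beta> Y \<Longrightarrow> eval_x F Q = 0" for F
  proof -
    have "F \<in> vanishing_ideal \<beta> Y"
      unfolding vanishing_ideal_def using that vanishes_on_iff[OF Y, of F]
      by (blast intro: ring_ideal.span_base)
    then show ?thesis
      using p P(1) that(1) by (auto simp: toric_zero_set_def vanishes_at_def)
  qed
  have torus: "in_torus P"
  proof (rule ccontr)
    assume "\<not> in_torus P"
    then obtain m where m: "m \<in> rel_lattice \<beta>"
      "\<And>N. 0 < N \<Longrightarrow> monom_val (pos_part (N *s m)) P = 0"
      "\<And>N. 0 < N \<Longrightarrow> monom_val (neg_part (N *s m)) P \<noteq> 0"
      using boundary_point_witness[OF fan P(2)] by blast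
    let ?n = "(int CARD('k) - 1) *s m"
    let ?F = "mono_x (pos_part ?n) - mono_x (neg_part ?n) :: ('r, 'k) cox"
    have "card {0, 1 :: 'k} \<le> CARD('k)"
      by (rule card_mono) auto
    then have pos: "0 < int CARD('k) - 1"
      by simp
    have "eval_x ?F P \<noteq> 0"
      unfolding eval_x_diff eval_x_mono_x using m(2)[OF pos] m(3)[OF pos] by simp
    moreover have "eval_x ?F P = 0"
    proof (rule vanish)
      show "homogeneous \<beta> ?F"
        by (rule homogeneous_lattice_binomial[OF rel_lattice_scale[OF m(1)]])
      show "eval_x ?F Q = 0" if "Q \<in> torus_reps \<beta> Y" for Q
        using that laurent_mono_scale_card[of Q m]
        by (simp add: eval_x_diff eval_x_mono_x monom_val_eq_iff pos_part_minus_neg_part torus_reps_def)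
    qed
    ultimately show False
      by simp
  qed
  show "p \<in> Y"
  proof (rule ccontr)
    assume "p \<notin> Y"
    then obtain F where "homogeneous \<beta> F" "eval_x F P \<noteq> 0"
      "\<And>Q. Q \<in> torus_reps \<beta> Y \<Longrightarrow> eval_x F Q = 0"
      using homogeneous_separation[OF torus] P(1) by blast
    then show False
      using vanish by blast
  qed
qed

theorem lemma4p2:
  fixes \<Sigma> :: "(real ^ 'n) set set"
    and \<phi> :: "int ^ 'n ^ 'r"
    and \<beta> :: "int ^ 'r ^ 'd"
    and Y :: "('k::{field,finite} alg_closure ^ 'r) set set"
  assumes "complete_fan \<Sigma>" and "simplicial_fan \<Sigma>" and "ray_matrix \<Sigma> \<phi>"
    and "CARD('r) = CARD('n) + CARD('d)" and "short_exact \<phi> \<beta>"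
    and "subgroup Y (torus_points \<beta>)"
  shows "(\<exists>!L. intermediate_lattice CARD('k) \<beta> L \<and> vanishing_ideal \<beta> Y = lattice_ideal L)
    \<and> (\<exists>L. intermediate_lattice CARD('k) \<beta> L
          \<and> Y = toric_zero_set \<Sigma> \<phi> \<beta> (lattice_ideal L))"
proof -
  let ?L = "char_kernel \<beta> (torus_reps \<beta> Y)"
  note Y = subgroup.subset[OF assms(6)]
  have L: "intermediate_lattice CARD('k) \<beta> ?L"
    by (rule char_kernel_intermediate) (simp add: torus_reps_def)
  have ideal: "vanishing_ideal \<beta> Y = lattice_ideal ?L"
    using vanishing_ideal_subset_lattice_ideal[OF assms(6)]
      lattice_ideal_subset_vanishing_ideal[OF Y] by blast
  have "L' = ?L" if "intermediate_lattice CARD('k) \<beta> L'" "vanishing_ideal \<beta> Y = lattice_ideal L'" for L'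
    by (rule lattice_ideal_inject[where 'k = 'k])
      (use that L ideal in \<open>auto simp: intermediate_lattice_def\<close>)
  moreover have "\<Sigma> \<noteq> {}"
    using assms(1) by (auto simp: complete_fan_def)
  then have "Y = toric_zero_set \<Sigma> \<phi> \<beta> (lattice_ideal ?L)"
    using toric_zero_set_vanishing_ideal[OF assms(2,3,5) _ Y] ideal by simp
  ultimately show ?thesis
    using L ideal by blast
qed

end
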